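(* Let $\psi_+:\mathcal X^+\times\mathcal Y^+\to\mathbb R$ be given by a $\mathcal K$-representation $$\psi_+(\xi,\eta)=\inf_{f_+,t_+,u_+}\{f_+^T\eta+t_+: P_+f_++t_+p_++Q_+u_++R_+\xi\leq_{\mathbf K_+}s_+\}\quad\forall\xi\in\mathcal X^+,\ \eta\in\mathcal Y^+\qquad[\mathbf K_+\in\mathcal K],$$ and let $x\mapsto Ax+b$ map $\mathcal X$ into $\mathcal X^+$ and $y\mapsto By+c$ map $\mathcal Y$ into $\mathcal Y^+$. Then for all $x\in\mathcal X$, $y\in\mathcal Y$ the function $\psi(x,y):=\psi_+(Ax+b,By+c)$ satisfies $$\psi(x,y)=\inf_{f,t,f_+,t_+,u_+}\left\{f^Ty+t:\ \begin{array}{l} f=B^Tf_+,\ t=t_++f_+^Tc,\\ P_+f_++t_+p_++Q_+u_++R_+Ax\leq_{\mathbf K_+}s_+-R_+b\end{array}\right\},$$ which is a $\mathcal K$-representation of $\psi$ on $\mathcal X\times\mathcal Y$.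
   Context: $\mathcal K$ is a fixed family of regular cones (closed, convex, pointed, with nonempty interior) in Euclidean spaces which contains $\mathbb R_+$, is closed under finite direct products, and is closed under passing to dual cones. $a\leq_{\mathbf K}b$ means $b-a\in\mathbf K$. Finite systems of $\mathcal K$-conic constraints, linear equalities and nonstrict linear inequalities are (equivalent to) a single $\mathcal K$-conic constraint. All sets $\mathcal X,\mathcal Y,\mathcal X^+,\mathcal Y^+$ are nonempty, convex and $\mathcal K$-representable, i.e. of the form $\{x:\exists u:Ax+Bu\leq_{\mathbf K}c\}$ with $\mathbf K\in\mathcal K$. A $\mathcal K$-representation of a real-valued function $\psi$ on $\mathcal X\times\mathcal Y$ (convex in $x\in\mathcal X$, concave in $y\in\mathcal Y$, continuous) is an identity $\psi(x,y)=\inf_{f,t,u}\{f^Ty+t:Pf+tp+Qu+Rx\leq_{\mathbf K}s\}$ valid for all $x\in\mathcal X,y\in\mathcal Y$, with $\mathbf K\in\mathcal K$ (the constraint may be given as an equivalent finite system). *)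

theory Defs
  imports
    "HOL-Analysis.Abstract_Euclidean_Space"
    "HOL-Library.Extended_Real"
    "Jordan_Normal_Form.Matrix"
begin

unbundle no vec_syntax
unbundle no inner_syntax
hide_const (open) Finite_Cartesian_Product.vec Finite_Cartesian_Product.vec_nth

text \<open>
  All dimensions vary inside the statement (a family of cones lives in Euclidean spaces of all
  dimensions), so the vectors of R^n are modelled by \<^term>\<open>carrier_vec n :: real vec set\<close>.
\<close>

text \<open>
  The type of vectors carries no topology; the standard one of R^n is transported from
  \<^const>\<open>Euclidean_space\<close>, whose points are the functions vanishing from index n on.
\<close>

definition rvec_topology :: "nat \<Rightarrow> real vec topology" where
  "rvec_topology n =
     pullback_topology (carrier_vec n) (\<lambda>v i. if i < n then v $ i else 0) (Euclidean_space n)"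

definition vec_convex :: "real vec set \<Rightarrow> bool" where
  "vec_convex X \<longleftrightarrow>
     (\<forall>x\<in>X. \<forall>y\<in>X. \<forall>a. 0 \<le> a \<and> a \<le> 1 \<longrightarrow> (1 - a) \<cdot>\<^sub>v x + a \<cdot>\<^sub>v y \<in> X)"

definition vec_convex_on :: "real vec set \<Rightarrow> (real vec \<Rightarrow> real) \<Rightarrow> bool" where
  "vec_convex_on X h \<longleftrightarrow> vec_convex X \<and>
     (\<forall>x\<in>X. \<forall>y\<in>X. \<forall>a. 0 \<le> a \<and> a \<le> 1 \<longrightarrow>
        h ((1 - a) \<cdot>\<^sub>v x + a \<cdot>\<^sub>v y) \<le> (1 - a) * h x + a * h y)"

definition regular_cone :: "nat \<Rightarrow> real vec set \<Rightarrow> bool" where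
  "regular_cone n K \<longleftrightarrow>
     K \<subseteq> carrier_vec n \<and>
     (\<forall>v\<in>K. \<forall>a\<ge>0. a \<cdot>\<^sub>v v \<in> K) \<and>
     closedin (rvec_topology n) K \<and>
     vec_convex K \<and>
     (\<forall>v\<in>K. - v \<in> K \<longrightarrow> v = 0\<^sub>v n) \<and>
     rvec_topology n interior_of K \<noteq> {}"

definition nonneg_ray :: "real vec set" where
  "nonneg_ray = {v \<in> carrier_vec 1. 0 \<le> v $ 0}"

definition cone_prod :: "real vec set \<Rightarrow> real vec set \<Rightarrow> real vec set" where
  "cone_prod K L = {v @\<^sub>v w | v w. v \<in> K \<and> w \<in> L}"

definition dual_cone :: "nat \<Rightarrow> real vec set \<Rightarrow> real vec set" where
  "dual_cone n K = {w \<in> carrier_vec n. \<forall>v\<in>K. 0 \<le> w \<bullet> v}"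

text \<open>A family \<open>\<K>\<close> of cones: \<open>\<K> n\<close> collects its members lying in R^n.\<close>

definition cone_family :: "(nat \<Rightarrow> real vec set set) \<Rightarrow> bool" where
  "cone_family \<K> \<longleftrightarrow>
     (\<forall>n. \<forall>K\<in>\<K> n. regular_cone n K) \<and>
     nonneg_ray \<in> \<K> 1 \<and>
     (\<forall>m n. \<forall>K\<in>\<K> m. \<forall>L\<in>\<K> n. cone_prod K L \<in> \<K> (m + n)) \<and>
     (\<forall>n. \<forall>K\<in>\<K> n. dual_cone n K \<in> \<K> n)"

definition cone_le :: "real vec set \<Rightarrow> real vec \<Rightarrow> real vec \<Rightarrow> bool" where
  "cone_le K a b \<longleftrightarrow> b - a \<in> K"

definition K_representable_set :: "(nat \<Rightarrow> real vec set set) \<Rightarrow> nat \<Rightarrow> real vec set \<Rightarrow> bool" where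
  "K_representable_set \<K> n X \<longleftrightarrow>
     (\<exists>k m A B c K. K \<in> \<K> k \<and> A \<in> carrier_mat k n \<and> B \<in> carrier_mat k m \<and> c \<in> carrier_vec k \<and>
        X = {x \<in> carrier_vec n. \<exists>u\<in>carrier_vec m. cone_le K (A *\<^sub>v x + B *\<^sub>v u) c})"

definition convex_concave_continuous ::
  "nat \<Rightarrow> nat \<Rightarrow> real vec set \<Rightarrow> real vec set \<Rightarrow> (real vec \<Rightarrow> real vec \<Rightarrow> real) \<Rightarrow> bool" where
  "convex_concave_continuous nx ny X Y \<psi> \<longleftrightarrow>
     (\<forall>y\<in>Y. vec_convex_on X (\<lambda>x. \<psi> x y)) \<and>
     (\<forall>x\<in>X. vec_convex_on Y (\<lambda>y. - \<psi> x y)) \<and>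
     continuous_map
       (prod_topology (subtopology (rvec_topology nx) X) (subtopology (rvec_topology ny) Y))
       euclideanreal (\<lambda>(x, y). \<psi> x y)"

text \<open>
  The data \<open>(K, P, p, Q, R, s)\<close>, with \<open>K\<close> in R^k and additional variables \<open>u\<close> in R^nu, form a
  representation of \<open>\<psi>\<close> on \<open>X \<times> Y\<close>. The infimum is taken in the extended reals, so equality with
  the real number \<open>\<psi> x y\<close> includes feasibility and boundedness from below.
\<close>

definition K_representation ::
  "(nat \<Rightarrow> real vec set set) \<Rightarrow> nat \<Rightarrow> nat \<Rightarrow> real vec set \<Rightarrow> real vec set \<Rightarrow>
   (real vec \<Rightarrow> real vec \<Rightarrow> real) \<Rightarrow> nat \<Rightarrow> nat \<Rightarrow> real vec set \<Rightarrow>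
   real mat \<Rightarrow> real vec \<Rightarrow> real mat \<Rightarrow> real mat \<Rightarrow> real vec \<Rightarrow> bool" where
  "K_representation \<K> nx ny X Y \<psi> nu k K P p Q R s \<longleftrightarrow>
     convex_concave_continuous nx ny X Y \<psi> \<and>
     K \<in> \<K> k \<and>
     P \<in> carrier_mat k ny \<and> p \<in> carrier_vec k \<and> Q \<in> carrier_mat k nu \<and>
     R \<in> carrier_mat k nx \<and> s \<in> carrier_vec k \<and>
     (\<forall>x\<in>X. \<forall>y\<in>Y. ereal (\<psi> x y) =
        Inf {ereal (f \<bullet> y + t) | f t u.
               f \<in> carrier_vec ny \<and> u \<in> carrier_vec nu \<and>
               cone_le K (P *\<^sub>v f + t \<cdot>\<^sub>v p + Q *\<^sub>v u + R *\<^sub>v x) s})"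

end

(*
  With f = B^T f_+ and t = t_+ + f_+^T c one has f^T y + t = f_+^T (B y + c) + t_+, so the infimum is
  that of the given representation at (A x + b, B y + c). A linear equality w = 0 is the conic
  constraint (w, -w) >= 0 in an orthant, so the two equalities can be absorbed one after the other
  into the cone by taking products with powers of the nonnegative ray.
*)
theory Submission
  imports Defs
begin

section \<open>Conic constraints and linear equalities\<close>

lemma append_mem_cone_prod_iff:
  assumes "K \<subseteq> carrier_vec m" "v \<in> carrier_vec m"
  shows "v @\<^sub>v w \<in> cone_prod K L \<longleftrightarrow> v \<in> K \<and> w \<in> L"
proof
  assume "v @\<^sub>v w \<in> cone_prod K L"
  then obtain v' w' where "v @\<^sub>v w = v' @\<^sub>v w'" "v' \<in> K" "w' \<in> L"
    by (auto simp: cone_prod_def)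
  moreover from this have "v = v' \<and> w = w'"
    using append_vec_eq[of v m v' w w'] assms by auto
  ultimately show "v \<in> K \<and> w \<in> L" by simp
qed (auto simp: cone_prod_def)

definition orthant :: "nat \<Rightarrow> real vec set" where
  "orthant n = {v \<in> carrier_vec n. \<forall>i<n. 0 \<le> v $ i}"

lemma orthant_Suc: "orthant (Suc n) = cone_prod nonneg_ray (orthant n)"
proof (intro equalityI subsetI)
  fix v assume v: "v \<in> orthant (Suc n)"
  define a where "a = vec 1 (\<lambda>_. v $ 0)"
  define w where "w = vec n (\<lambda>i. v $ Suc i)"
  have "v = a @\<^sub>v w"
    using v by (intro eq_vecI) (auto simp: orthant_def a_def w_def)
  moreover have "a \<in> nonneg_ray" "w \<in> orthant n"
    using v by (auto simp: orthant_def nonneg_ray_def a_def w_def)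
  ultimately show "v \<in> cone_prod nonneg_ray (orthant n)"
    by (auto simp: cone_prod_def)
next
  fix u assume "u \<in> cone_prod nonneg_ray (orthant n)"
  then obtain v w where u: "u = v @\<^sub>v w" "v \<in> nonneg_ray" "w \<in> orthant n"
    by (auto simp: cone_prod_def)
  then have "v @\<^sub>v w \<in> carrier_vec (1 + n)"
    by (intro append_carrier_vec) (simp_all add: nonneg_ray_def orthant_def)
  with u show "u \<in> orthant (Suc n)"
    by (auto simp: orthant_def nonneg_ray_def)
qed

lemma orthant_in_cone_family:
  assumes "cone_family \<K>" "n > 0"
  shows "orthant n \<in> \<K> n"
  using \<open>n > 0\<close>
proof (induction n rule: nat_induct_non_zero)
  case 1
  have "orthant 1 = nonneg_ray" by (auto simp: orthant_def nonneg_ray_def)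
  then show ?case using assms(1) by (simp add: cone_family_def)
next
  case (Suc n)
  have "cone_prod nonneg_ray (orthant n) \<in> \<K> (1 + n)"
    using assms(1) Suc.IH unfolding cone_family_def by blast
  then show ?case by (simp add: orthant_Suc)
qed

lemma append_uminus_mem_orthant_iff:
  assumes "w \<in> carrier_vec d"
  shows "w @\<^sub>v (- w) \<in> orthant (d + d) \<longleftrightarrow> w = 0\<^sub>v d"
proof
  assume w: "w @\<^sub>v (- w) \<in> orthant (d + d)"
  show "w = 0\<^sub>v d"
  proof (rule eq_vecI)
    fix i assume "i < dim_vec (0\<^sub>v d :: real vec)"
    then have i: "i < d" by simp
    have "0 \<le> (w @\<^sub>v (- w)) $ i" "0 \<le> (w @\<^sub>v (- w)) $ (d + i)"
      using w i by (auto simp: orthant_def)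
    then show "w $ i = 0\<^sub>v d $ i" using assms i by simp
  qed (use assms in simp)
qed (use assms in \<open>auto simp: orthant_def\<close>)

lemma zero_mat_mult_vec:
  fixes v :: "'a :: semiring_0 vec"
  assumes "v \<in> carrier_vec n"
  shows "0\<^sub>m k n *\<^sub>v v = 0\<^sub>v k"
  using assms by (intro eq_vecI) auto

lemma ex_mat_mult_append:
  fixes A B :: "'a :: semiring_0 mat"
  assumes "A \<in> carrier_mat k n" "B \<in> carrier_mat k m"
  obtains M where "M \<in> carrier_mat k (n + m)"
    "\<And>v w. v \<in> carrier_vec n \<Longrightarrow> w \<in> carrier_vec m \<Longrightarrow> M *\<^sub>v (v @\<^sub>v w) = A *\<^sub>v v + B *\<^sub>v w"
proof
  define M where "M = mat_of_rows (n + m) (map (\<lambda>i. row A i @\<^sub>v row B i) [0..<k])"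
  show M: "M \<in> carrier_mat k (n + m)"
    by (auto simp: M_def)
  fix v w :: "'a vec" assume v: "v \<in> carrier_vec n" and w: "w \<in> carrier_vec m"
  show "M *\<^sub>v (v @\<^sub>v w) = A *\<^sub>v v + B *\<^sub>v w"
  proof (rule eq_vecI)
    fix i assume "i < dim_vec (A *\<^sub>v v + B *\<^sub>v w)"
    then have i: "i < k" using assms by simp
    have r: "row A i \<in> carrier_vec n" "row B i \<in> carrier_vec m" using assms i by auto
    then have "row M i = row A i @\<^sub>v row B i"
      using i by (simp add: M_def)
    then show "(M *\<^sub>v (v @\<^sub>v w)) $ i = (A *\<^sub>v v + B *\<^sub>v w) $ i"
      using M assms i by (simp add: scalar_prod_append[OF r v w])
  qed (use M assms in simp)
qed

lemma ex_mat_mult_append_scalar: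
  fixes A Q :: "'a :: comm_semiring_1 mat"
  assumes A: "A \<in> carrier_mat k n" and p: "p \<in> carrier_vec k" and Q: "Q \<in> carrier_mat k m"
  obtains M where "M \<in> carrier_mat k (n + (1 + m))"
    "\<And>v t w. v \<in> carrier_vec n \<Longrightarrow> w \<in> carrier_vec m \<Longrightarrow>
       M *\<^sub>v (v @\<^sub>v (vec 1 (\<lambda>_. t) @\<^sub>v w)) = A *\<^sub>v v + t \<cdot>\<^sub>v p + Q *\<^sub>v w"
proof -
  define C where "C = mat k 1 (\<lambda>(i, j). p $ i)"
  have C: "C \<in> carrier_mat k 1" by (simp add: C_def)
  have Ct: "C *\<^sub>v vec 1 (\<lambda>_. t) = t \<cdot>\<^sub>v p" for t
    using p by (intro eq_vecI) (auto simp: C_def scalar_prod_def mult.commute)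
  obtain N where N: "N \<in> carrier_mat k (1 + m)"
    "\<And>v w. v \<in> carrier_vec 1 \<Longrightarrow> w \<in> carrier_vec m \<Longrightarrow> N *\<^sub>v (v @\<^sub>v w) = C *\<^sub>v v + Q *\<^sub>v w"
    using ex_mat_mult_append[OF C Q] by blast
  obtain M where M: "M \<in> carrier_mat k (n + (1 + m))"
    "\<And>v w. v \<in> carrier_vec n \<Longrightarrow> w \<in> carrier_vec (1 + m) \<Longrightarrow> M *\<^sub>v (v @\<^sub>v w) = A *\<^sub>v v + N *\<^sub>v w"
    using ex_mat_mult_append[OF A N(1)] by blast
  show thesis
  proof (rule that[OF M(1)])
    fix v w :: "'a vec" and t assume v: "v \<in> carrier_vec n" and w: "w \<in> carrier_vec m"
    have "vec 1 (\<lambda>_. t) @\<^sub>v w \<in> carrier_vec (1 + m)" using w by (intro append_carrier_vec) auto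
    then have "M *\<^sub>v (v @\<^sub>v (vec 1 (\<lambda>_. t) @\<^sub>v w)) = A *\<^sub>v v + (t \<cdot>\<^sub>v p + Q *\<^sub>v w)"
      using M(2)[OF v] N(2)[OF vec_carrier w] by (simp only: Ct)
    also have "\<dots> = A *\<^sub>v v + t \<cdot>\<^sub>v p + Q *\<^sub>v w"
      using A p Q v w by (intro assoc_add_vec[symmetric, of _ k]) auto
    finally show "M *\<^sub>v (v @\<^sub>v (vec 1 (\<lambda>_. t) @\<^sub>v w)) = A *\<^sub>v v + t \<cdot>\<^sub>v p + Q *\<^sub>v w" .
  qed
qed

lemma carrier_vec_append_scalarE:
  assumes "u \<in> carrier_vec (n + (1 + m))"
  obtains v t w where "v \<in> carrier_vec n" "w \<in> carrier_vec m" "u = v @\<^sub>v (vec 1 (\<lambda>_. t) @\<^sub>v w)"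
proof
  show "u = vec n (\<lambda>i. u $ i) @\<^sub>v (vec 1 (\<lambda>_. u $ n) @\<^sub>v vec m (\<lambda>i. u $ (n + 1 + i)))"
    using assms by (intro eq_vecI) (auto simp: not_less le_less_Suc_eq)
qed auto

definition conic_constraint ::
  "(nat \<Rightarrow> real vec set set) \<Rightarrow> nat \<Rightarrow> nat \<Rightarrow> nat \<Rightarrow>
   (real vec \<Rightarrow> real \<Rightarrow> real vec \<Rightarrow> real vec \<Rightarrow> bool) \<Rightarrow> bool" where
  "conic_constraint \<K> nf nu nx C \<longleftrightarrow>
     (\<exists>l K P p Q R s. K \<in> \<K> l \<and>
        P \<in> carrier_mat l nf \<and> p \<in> carrier_vec l \<and> Q \<in> carrier_mat l nu \<and>
        R \<in> carrier_mat l nx \<and> s \<in> carrier_vec l \<and>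
        (\<forall>f\<in>carrier_vec nf. \<forall>t. \<forall>u\<in>carrier_vec nu. \<forall>x\<in>carrier_vec nx.
           C f t u x \<longleftrightarrow> cone_le K (P *\<^sub>v f + t \<cdot>\<^sub>v p + Q *\<^sub>v u + R *\<^sub>v x) s))"

lemma conic_constraint_conj_equality:
  assumes \<K>: "cone_family \<K>"
    and C: "conic_constraint \<K> nf nu nx C"
    and M: "M \<in> carrier_mat d nf" "m \<in> carrier_vec d" "N \<in> carrier_mat d nu"
  shows "conic_constraint \<K> nf nu nx
           (\<lambda>f t u x. C f t u x \<and> M *\<^sub>v f + t \<cdot>\<^sub>v m + N *\<^sub>v u = 0\<^sub>v d)"
proof (cases "d = 0")
  \<comment> \<open>The family need not contain a cone in R^0, so \<open>orthant 0\<close> is not available here.\<close>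
  case True
  then have "M *\<^sub>v f + t \<cdot>\<^sub>v m + N *\<^sub>v u = 0\<^sub>v d" for f t u
    using M by (intro eq_vecI) auto
  then show ?thesis using C by simp
next
  case False
  obtain l K P p Q R s where K: "K \<in> \<K> l"
    and c: "P \<in> carrier_mat l nf" "p \<in> carrier_vec l" "Q \<in> carrier_mat l nu"
        "R \<in> carrier_mat l nx" "s \<in> carrier_vec l"
    and iff: "\<And>f t u x. f \<in> carrier_vec nf \<Longrightarrow> u \<in> carrier_vec nu \<Longrightarrow> x \<in> carrier_vec nx \<Longrightarrow>
        C f t u x \<longleftrightarrow> cone_le K (P *\<^sub>v f + t \<cdot>\<^sub>v p + Q *\<^sub>v u + R *\<^sub>v x) s"
    using C unfolding conic_constraint_def by metis
  define d' where "d' = d + d"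
  define K' where "K' = cone_prod K (orthant d')"
  have K': "K' \<in> \<K> (l + d')"
    using \<K> K orthant_in_cone_family[OF \<K>, of d'] False
    unfolding K'_def cone_family_def d'_def by blast
  have Kl: "K \<subseteq> carrier_vec l"
    using \<K> K by (auto simp: cone_family_def regular_cone_def)
  define P' where "P' = P @\<^sub>r (- M @\<^sub>r M)"
  define p' where "p' = p @\<^sub>v (- m @\<^sub>v m)"
  define Q' where "Q' = Q @\<^sub>r (- N @\<^sub>r N)"
  define R' where "R' = R @\<^sub>r 0\<^sub>m d' nx"
  define s' where "s' = s @\<^sub>v 0\<^sub>v d'"
  have carr: "P' \<in> carrier_mat (l + d') nf" "p' \<in> carrier_vec (l + d')"
    "Q' \<in> carrier_mat (l + d') nu" "R' \<in> carrier_mat (l + d') nx" "s' \<in> carrier_vec (l + d')"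
    using c M by (auto simp: P'_def p'_def Q'_def R'_def s'_def d'_def)
  have "C f t u x \<and> M *\<^sub>v f + t \<cdot>\<^sub>v m + N *\<^sub>v u = 0\<^sub>v d \<longleftrightarrow>
        cone_le K' (P' *\<^sub>v f + t \<cdot>\<^sub>v p' + Q' *\<^sub>v u + R' *\<^sub>v x) s'"
    if v: "f \<in> carrier_vec nf" "u \<in> carrier_vec nu" "x \<in> carrier_vec nx" for f t u x
  proof -
    define w where "w = M *\<^sub>v f + t \<cdot>\<^sub>v m + N *\<^sub>v u"
    have w: "w \<in> carrier_vec d" using M v by (simp add: w_def)
    have P'f: "P' *\<^sub>v f = P *\<^sub>v f @\<^sub>v (- (M *\<^sub>v f) @\<^sub>v M *\<^sub>v f)"
      unfolding P'_def using c M v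
      by (simp add: mat_mult_append[of _ l nf _ d'] mat_mult_append[of _ d nf _ d] d'_def)
    have Q'u: "Q' *\<^sub>v u = Q *\<^sub>v u @\<^sub>v (- (N *\<^sub>v u) @\<^sub>v N *\<^sub>v u)"
      unfolding Q'_def using c M v
      by (simp add: mat_mult_append[of _ l nu _ d'] mat_mult_append[of _ d nu _ d] d'_def)
    have R'x: "R' *\<^sub>v x = R *\<^sub>v x @\<^sub>v 0\<^sub>v d'"
      unfolding R'_def using c v by (simp add: mat_mult_append[of _ l nx _ d'] zero_mat_mult_vec)
    have "s' - (P' *\<^sub>v f + t \<cdot>\<^sub>v p' + Q' *\<^sub>v u + R' *\<^sub>v x) =
        (s - (P *\<^sub>v f + t \<cdot>\<^sub>v p + Q *\<^sub>v u + R *\<^sub>v x)) @\<^sub>v (w @\<^sub>v (- w))"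
      unfolding P'f Q'u R'x p'_def s'_def w_def d'_def using c M v
      by (intro eq_vecI) (auto simp del: index_mult_mat_vec)
    then show ?thesis
      using append_mem_cone_prod_iff[OF Kl, of "s - (P *\<^sub>v f + t \<cdot>\<^sub>v p + Q *\<^sub>v u + R *\<^sub>v x)"]
        append_uminus_mem_orthant_iff[OF w] iff[OF v] c v
      by (simp add: cone_le_def K'_def d'_def w_def)
  qed
  then show ?thesis
    unfolding conic_constraint_def using K' carr by blast
qed

section \<open>Affine substitution\<close>

lemma topspace_rvec_topology [simp]: "topspace (rvec_topology n) = carrier_vec n"
  by (auto simp: rvec_topology_def topspace_pullback_topology topspace_Euclidean_space)

lemma continuous_map_rvec_coordinate:
  assumes "i < n"
  shows "continuous_map (rvec_topology n) euclideanreal (\<lambda>v. v $ i)"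
proof -
  have "continuous_map (Euclidean_space n) euclideanreal (\<lambda>x. x i)"
    unfolding Euclidean_space_def
    by (intro continuous_map_from_subtopology continuous_map_product_projection) auto
  from continuous_map_pullback[OF this, of "carrier_vec n" "\<lambda>v i. if i < n then v $ i else 0"]
  show ?thesis using assms by (simp add: rvec_topology_def comp_def)
qed

lemma continuous_map_into_rvec_topology:
  assumes "\<And>x. x \<in> topspace T \<Longrightarrow> g x \<in> carrier_vec n"
    and "\<And>i. i < n \<Longrightarrow> continuous_map T euclideanreal (\<lambda>x. g x $ i)"
  shows "continuous_map T (rvec_topology n) g"
  unfolding rvec_topology_def
proof (rule continuous_map_pullback')
  show "continuous_map T (Euclidean_space n) ((\<lambda>v i. if i < n then v $ i else 0) \<circ> g)"
    using assms(2) by (simp add: comp_def continuous_map_componentwise_Euclidean_space)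
qed (use assms(1) in auto)

lemma continuous_map_rvec_affine:
  assumes A: "A \<in> carrier_mat m n" and b: "b \<in> carrier_vec m"
  shows "continuous_map (rvec_topology n) (rvec_topology m) (\<lambda>x. A *\<^sub>v x + b)"
proof (rule continuous_map_into_rvec_topology)
  fix i assume i: "i < m"
  have "continuous_map (rvec_topology n) euclideanreal
          (\<lambda>x. (\<Sum>j\<in>{0..<n}. row A i $ j * x $ j) + b $ i)"
    by (intro continuous_intros continuous_map_rvec_coordinate) auto
  then show "continuous_map (rvec_topology n) euclideanreal (\<lambda>x. (A *\<^sub>v x + b) $ i)"
    by (rule continuous_map_eq) (use A b i in \<open>auto simp: scalar_prod_def\<close>)
qed (use A b in auto)

lemma affine_convex_combination:
  fixes A :: "real mat"
  assumes "A \<in> carrier_mat m n" "b \<in> carrier_vec m" "x \<in> carrier_vec n" "y \<in> carrier_vec n"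
  shows "A *\<^sub>v ((1 - a) \<cdot>\<^sub>v x + a \<cdot>\<^sub>v y) + b = (1 - a) \<cdot>\<^sub>v (A *\<^sub>v x + b) + a \<cdot>\<^sub>v (A *\<^sub>v y + b)"
proof -
  have "A *\<^sub>v ((1 - a) \<cdot>\<^sub>v x + a \<cdot>\<^sub>v y) = (1 - a) \<cdot>\<^sub>v (A *\<^sub>v x) + a \<cdot>\<^sub>v (A *\<^sub>v y)"
    using assms by (simp add: mult_add_distrib_mat_vec[of _ m n] mult_mat_vec[of _ m n])
  then show ?thesis
    using assms by (intro eq_vecI) (auto simp del: index_mult_mat_vec simp: algebra_simps)
qed

lemma vec_convex_on_affine:
  assumes h: "vec_convex_on Z h" and X: "vec_convex X" "X \<subseteq> carrier_vec n"
    and A: "A \<in> carrier_mat m n" "b \<in> carrier_vec m" "\<And>x. x \<in> X \<Longrightarrow> A *\<^sub>v x + b \<in> Z"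
    and g: "\<And>x. x \<in> X \<Longrightarrow> g x = h (A *\<^sub>v x + b)"
  shows "vec_convex_on X g"
  unfolding vec_convex_on_def
proof (intro conjI ballI allI impI)
  fix x y and a :: real
  assume x: "x \<in> X" and y: "y \<in> X" and a: "0 \<le> a \<and> a \<le> 1"
  then have "(1 - a) \<cdot>\<^sub>v x + a \<cdot>\<^sub>v y \<in> X" using X by (auto simp: vec_convex_def)
  moreover have "A *\<^sub>v ((1 - a) \<cdot>\<^sub>v x + a \<cdot>\<^sub>v y) + b
      = (1 - a) \<cdot>\<^sub>v (A *\<^sub>v x + b) + a \<cdot>\<^sub>v (A *\<^sub>v y + b)"
    using affine_convex_combination A x y X by blast
  ultimately show "g ((1 - a) \<cdot>\<^sub>v x + a \<cdot>\<^sub>v y) \<le> (1 - a) * g x + a * g y"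
    using h A(3) x y a g by (simp add: vec_convex_on_def)
qed (use X in simp)

lemma convex_concave_continuous_affine:
  assumes \<psi>p: "convex_concave_continuous n\<xi> n\<eta> Xp Yp \<psi>p"
    and X: "vec_convex X" "X \<subseteq> carrier_vec nx" and Y: "vec_convex Y" "Y \<subseteq> carrier_vec ny"
    and A: "A \<in> carrier_mat n\<xi> nx" "b \<in> carrier_vec n\<xi>" "\<And>x. x \<in> X \<Longrightarrow> A *\<^sub>v x + b \<in> Xp"
    and B: "B \<in> carrier_mat n\<eta> ny" "c \<in> carrier_vec n\<eta>" "\<And>y. y \<in> Y \<Longrightarrow> B *\<^sub>v y + c \<in> Yp"
    and \<psi>: "\<And>x y. x \<in> X \<Longrightarrow> y \<in> Y \<Longrightarrow> \<psi> x y = \<psi>p (A *\<^sub>v x + b) (B *\<^sub>v y + c)"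
  shows "convex_concave_continuous nx ny X Y \<psi>"
  unfolding convex_concave_continuous_def
proof (intro conjI ballI)
  fix y assume "y \<in> Y"
  then show "vec_convex_on X (\<lambda>x. \<psi> x y)"
    using \<psi>p B(3) \<psi> unfolding convex_concave_continuous_def
    by (intro vec_convex_on_affine[OF _ X A, of "\<lambda>\<xi>. \<psi>p \<xi> (B *\<^sub>v y + c)"]) auto
next
  fix x assume "x \<in> X"
  then show "vec_convex_on Y (\<lambda>y. - \<psi> x y)"
    using \<psi>p A(3) \<psi> unfolding convex_concave_continuous_def
    by (intro vec_convex_on_affine[OF _ Y B, of "\<lambda>\<eta>. - \<psi>p (A *\<^sub>v x + b) \<eta>"]) auto
next
  let ?TX = "subtopology (rvec_topology nx) X" and ?TY = "subtopology (rvec_topology ny) Y"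
  have "continuous_map ?TX (subtopology (rvec_topology n\<xi>) Xp) (\<lambda>x. A *\<^sub>v x + b)"
    using A by (intro continuous_map_into_subtopology continuous_map_from_subtopology
      continuous_map_rvec_affine) auto
  moreover have "continuous_map ?TY (subtopology (rvec_topology n\<eta>) Yp) (\<lambda>y. B *\<^sub>v y + c)"
    using B by (intro continuous_map_into_subtopology continuous_map_from_subtopology
      continuous_map_rvec_affine) auto
  ultimately have "continuous_map (prod_topology ?TX ?TY)
      (prod_topology (subtopology (rvec_topology n\<xi>) Xp) (subtopology (rvec_topology n\<eta>) Yp))
      (\<lambda>(x, y). (A *\<^sub>v x + b, B *\<^sub>v y + c))"
    by (simp add: continuous_map_prod_top)
  moreover have "continuous_map
      (prod_topology (subtopology (rvec_topology n\<xi>) Xp) (subtopology (rvec_topology n\<eta>) Yp))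
      euclideanreal (\<lambda>(x, y). \<psi>p x y)"
    using \<psi>p by (simp add: convex_concave_continuous_def)
  ultimately have "continuous_map (prod_topology ?TX ?TY) euclideanreal
      ((\<lambda>(x, y). \<psi>p x y) \<circ> (\<lambda>(x, y). (A *\<^sub>v x + b, B *\<^sub>v y + c)))"
    by (rule continuous_map_compose)
  then show "continuous_map (prod_topology ?TX ?TY) euclideanreal (\<lambda>(x, y). \<psi> x y)"
    by (rule continuous_map_eq) (auto simp: \<psi>)
qed

theorem mainTheorem6:
  fixes \<K> :: "nat \<Rightarrow> real vec set set"
    and nx ny n\<xi> n\<eta> nu k :: nat
    and X Y Xp Yp Kp :: "real vec set"
    and \<psi> \<psi>p :: "real vec \<Rightarrow> real vec \<Rightarrow> real"
    and Pp Qp Rp A B :: "real mat"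
    and pp sp b c :: "real vec"
  assumes "cone_family \<K>"
    and "X \<subseteq> carrier_vec nx" "X \<noteq> {}" "vec_convex X" "K_representable_set \<K> nx X"
    and "Y \<subseteq> carrier_vec ny" "Y \<noteq> {}" "vec_convex Y" "K_representable_set \<K> ny Y"
    and "Xp \<subseteq> carrier_vec n\<xi>" "Xp \<noteq> {}" "vec_convex Xp" "K_representable_set \<K> n\<xi> Xp"
    and "Yp \<subseteq> carrier_vec n\<eta>" "Yp \<noteq> {}" "vec_convex Yp" "K_representable_set \<K> n\<eta> Yp"
    and "K_representation \<K> n\<xi> n\<eta> Xp Yp \<psi>p nu k Kp Pp pp Qp Rp sp"
    and "A \<in> carrier_mat n\<xi> nx" "b \<in> carrier_vec n\<xi>" "\<forall>x\<in>X. A *\<^sub>v x + b \<in> Xp"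
    and "B \<in> carrier_mat n\<eta> ny" "c \<in> carrier_vec n\<eta>" "\<forall>y\<in>Y. B *\<^sub>v y + c \<in> Yp"
    and "\<forall>x\<in>X. \<forall>y\<in>Y. \<psi> x y = \<psi>p (A *\<^sub>v x + b) (B *\<^sub>v y + c)"
  defines "feasible \<equiv> \<lambda>x f t fp tp up.
      f = B\<^sup>T *\<^sub>v fp \<and> t = tp + fp \<bullet> c \<and>
      cone_le Kp (Pp *\<^sub>v fp + tp \<cdot>\<^sub>v pp + Qp *\<^sub>v up + Rp *\<^sub>v (A *\<^sub>v x)) (sp - Rp *\<^sub>v b)"
  shows "(\<forall>x\<in>X. \<forall>y\<in>Y. ereal (\<psi> x y) =
            Inf {ereal (f \<bullet> y + t) | f t fp tp up.
                   f \<in> carrier_vec ny \<and> fp \<in> carrier_vec n\<eta> \<and> up \<in> carrier_vec nu \<and>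
                   feasible x f t fp tp up}) \<and>
         (\<comment> \<open>the system above is equivalent to a single conic constraint in the variables \<open>f\<close>, \<open>t\<close>
             and \<open>u = (fp, tp, up)\<close>, and this constraint represents \<open>\<psi>\<close>\<close>
          \<exists>l K P p Q R s.
            K_representation \<K> nx ny X Y \<psi> (n\<eta> + (1 + nu)) l K P p Q R s \<and>
            (\<forall>x\<in>carrier_vec nx. \<forall>f\<in>carrier_vec ny. \<forall>t.
             \<forall>fp\<in>carrier_vec n\<eta>. \<forall>tp. \<forall>up\<in>carrier_vec nu.
               feasible x f t fp tp up \<longleftrightarrow>
               cone_le K (P *\<^sub>v f + t \<cdot>\<^sub>v p + Q *\<^sub>v (fp @\<^sub>v (vec 1 (\<lambda>_. tp) @\<^sub>v up)) + R *\<^sub>v x) s))"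
proof -
  have \<psi>p: "convex_concave_continuous n\<xi> n\<eta> Xp Yp \<psi>p" and Kp: "Kp \<in> \<K> k"
    and dims: "Pp \<in> carrier_mat k n\<eta>" "pp \<in> carrier_vec k" "Qp \<in> carrier_mat k nu"
      "Rp \<in> carrier_mat k n\<xi>" "sp \<in> carrier_vec k"
    and inf: "\<And>\<xi> \<eta>. \<xi> \<in> Xp \<Longrightarrow> \<eta> \<in> Yp \<Longrightarrow> ereal (\<psi>p \<xi> \<eta>) =
        Inf {ereal (f \<bullet> \<eta> + t) | f t u.
               f \<in> carrier_vec n\<eta> \<and> u \<in> carrier_vec nu \<and>
               cone_le Kp (Pp *\<^sub>v f + t \<cdot>\<^sub>v pp + Qp *\<^sub>v u + Rp *\<^sub>v \<xi>) sp}"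
    using assms(18) unfolding K_representation_def by blast+
  note X = assms(2) and Y = assms(6)
  note A = assms(19,20) and AX = assms(21)[rule_format]
  note B = assms(22,23) and BY = assms(24)[rule_format]
  note \<psi> = assms(25)[rule_format]
  have inf': "ereal (\<psi> x y) =
      Inf {ereal (f \<bullet> y + t) | f t fp tp up.
             f \<in> carrier_vec ny \<and> fp \<in> carrier_vec n\<eta> \<and> up \<in> carrier_vec nu \<and>
             feasible x f t fp tp up}"
    if xy: "x \<in> X" "y \<in> Y" for x y
  proof -
    have x: "x \<in> carrier_vec nx" and y: "y \<in> carrier_vec ny" using xy X Y by auto
    have cone: "cone_le Kp (Pp *\<^sub>v fp + tp \<cdot>\<^sub>v pp + Qp *\<^sub>v up + Rp *\<^sub>v (A *\<^sub>v x + b)) sp \<longleftrightarrow>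
        cone_le Kp (Pp *\<^sub>v fp + tp \<cdot>\<^sub>v pp + Qp *\<^sub>v up + Rp *\<^sub>v (A *\<^sub>v x)) (sp - Rp *\<^sub>v b)"
      if "fp \<in> carrier_vec n\<eta>" "up \<in> carrier_vec nu" for fp tp up
    proof -
      have "Rp *\<^sub>v (A *\<^sub>v x + b) = Rp *\<^sub>v (A *\<^sub>v x) + Rp *\<^sub>v b"
        using dims A x by (intro mult_add_distrib_mat_vec) auto
      then have "sp - (Pp *\<^sub>v fp + tp \<cdot>\<^sub>v pp + Qp *\<^sub>v up + Rp *\<^sub>v (A *\<^sub>v x + b)) =
          sp - Rp *\<^sub>v b - (Pp *\<^sub>v fp + tp \<cdot>\<^sub>v pp + Qp *\<^sub>v up + Rp *\<^sub>v (A *\<^sub>v x))"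
        using dims A x that by (intro eq_vecI) (auto simp del: index_mult_mat_vec)
      then show ?thesis by (simp add: cone_le_def)
    qed
    have obj: "(B\<^sup>T *\<^sub>v fp) \<bullet> y + (tp + fp \<bullet> c) = fp \<bullet> (B *\<^sub>v y + c) + tp"
      if "fp \<in> carrier_vec n\<eta>" for fp tp
      using that B y
      by (simp add: transpose_vec_mult_scalar[of _ n\<eta> ny] scalar_prod_add_distrib[of _ n\<eta>])
    have BT: "B\<^sup>T *\<^sub>v fp \<in> carrier_vec ny" if "fp \<in> carrier_vec n\<eta>" for fp
      using that B by simp
    have "{ereal (f \<bullet> y + t) | f t fp tp up.
             f \<in> carrier_vec ny \<and> fp \<in> carrier_vec n\<eta> \<and> up \<in> carrier_vec nu \<and>
             feasible x f t fp tp up} =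
          {ereal ((B\<^sup>T *\<^sub>v fp) \<bullet> y + (tp + fp \<bullet> c)) | fp tp up.
             fp \<in> carrier_vec n\<eta> \<and> up \<in> carrier_vec nu \<and>
             cone_le Kp (Pp *\<^sub>v fp + tp \<cdot>\<^sub>v pp + Qp *\<^sub>v up + Rp *\<^sub>v (A *\<^sub>v x)) (sp - Rp *\<^sub>v b)}"
      unfolding feasible_def using BT by blast
    also have "\<dots> = {ereal (f \<bullet> (B *\<^sub>v y + c) + t) | f t u.
             f \<in> carrier_vec n\<eta> \<and> u \<in> carrier_vec nu \<and>
             cone_le Kp (Pp *\<^sub>v f + t \<cdot>\<^sub>v pp + Qp *\<^sub>v u + Rp *\<^sub>v (A *\<^sub>v x + b)) sp}"
      by (intro Collect_cong iff_exI) (use obj cone in auto)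
    finally show ?thesis
      using inf[OF AX[OF xy(1)] BY[OF xy(2)]] \<psi>[OF xy] by simp
  qed
  let ?nu = "n\<eta> + (1 + nu)"
  obtain N0 where N0: "N0 \<in> carrier_mat k ?nu"
    "\<And>fp tp up. fp \<in> carrier_vec n\<eta> \<Longrightarrow> up \<in> carrier_vec nu \<Longrightarrow>
       N0 *\<^sub>v (fp @\<^sub>v (vec 1 (\<lambda>_. tp) @\<^sub>v up)) = Pp *\<^sub>v fp + tp \<cdot>\<^sub>v pp + Qp *\<^sub>v up"
    using ex_mat_mult_append_scalar[OF dims(1-3)] by blast
  obtain N1 where N1: "N1 \<in> carrier_mat ny ?nu"
    "\<And>fp tp up. fp \<in> carrier_vec n\<eta> \<Longrightarrow> up \<in> carrier_vec nu \<Longrightarrow>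
       N1 *\<^sub>v (fp @\<^sub>v (vec 1 (\<lambda>_. tp) @\<^sub>v up)) = - B\<^sup>T *\<^sub>v fp + tp \<cdot>\<^sub>v 0\<^sub>v ny + 0\<^sub>m ny nu *\<^sub>v up"
    using ex_mat_mult_append_scalar[of "- B\<^sup>T" ny n\<eta> "0\<^sub>v ny" "0\<^sub>m ny nu" nu] B by auto
  define C where "C = mat 1 n\<eta> (\<lambda>(i, j). - c $ j)"
  have C: "C \<in> carrier_mat 1 n\<eta>" by (simp add: C_def)
  have Cf: "C *\<^sub>v fp = vec 1 (\<lambda>_. - (fp \<bullet> c))" if "fp \<in> carrier_vec n\<eta>" for fp
    using that B by (intro eq_vecI) (auto simp: C_def scalar_prod_def sum_negf mult.commute)
  obtain N2 where N2: "N2 \<in> carrier_mat 1 ?nu"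
    "\<And>fp tp up. fp \<in> carrier_vec n\<eta> \<Longrightarrow> up \<in> carrier_vec nu \<Longrightarrow>
       N2 *\<^sub>v (fp @\<^sub>v (vec 1 (\<lambda>_. tp) @\<^sub>v up)) = C *\<^sub>v fp + tp \<cdot>\<^sub>v vec 1 (\<lambda>_. - 1) + 0\<^sub>m 1 nu *\<^sub>v up"
    using ex_mat_mult_append_scalar[OF C, of "vec 1 (\<lambda>_. - 1)" "0\<^sub>m 1 nu" nu] by auto
  have "conic_constraint \<K> ny ?nu nx
      (\<lambda>f t u x. cone_le Kp (0\<^sub>m k ny *\<^sub>v f + t \<cdot>\<^sub>v 0\<^sub>v k + N0 *\<^sub>v u + (Rp * A) *\<^sub>v x) (sp - Rp *\<^sub>v b))"
    unfolding conic_constraint_def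
    by (rule exI[of _ k], rule exI[of _ Kp], rule exI[of _ "0\<^sub>m k ny"], rule exI[of _ "0\<^sub>v k"],
        rule exI[of _ N0], rule exI[of _ "Rp * A"], rule exI[of _ "sp - Rp *\<^sub>v b"])
      (use Kp dims A N0 in auto)
  from conic_constraint_conj_equality[OF assms(1) this, of "1\<^sub>m ny" ny "0\<^sub>v ny" N1]
  have "conic_constraint \<K> ny ?nu nx
      (\<lambda>f t u x. cone_le Kp (0\<^sub>m k ny *\<^sub>v f + t \<cdot>\<^sub>v 0\<^sub>v k + N0 *\<^sub>v u + (Rp * A) *\<^sub>v x) (sp - Rp *\<^sub>v b) \<and>
         1\<^sub>m ny *\<^sub>v f + t \<cdot>\<^sub>v 0\<^sub>v ny + N1 *\<^sub>v u = 0\<^sub>v ny)"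
    using N1 by simp
  from conic_constraint_conj_equality[OF assms(1) this, of "0\<^sub>m 1 ny" 1 "vec 1 (\<lambda>_. 1)" N2]
  obtain l K P p Q R s where K: "K \<in> \<K> l"
    and carr: "P \<in> carrier_mat l ny" "p \<in> carrier_vec l" "Q \<in> carrier_mat l ?nu"
      "R \<in> carrier_mat l nx" "s \<in> carrier_vec l"
    and iff: "\<And>f t u x. f \<in> carrier_vec ny \<Longrightarrow> u \<in> carrier_vec ?nu \<Longrightarrow> x \<in> carrier_vec nx \<Longrightarrow>
      (cone_le Kp (0\<^sub>m k ny *\<^sub>v f + t \<cdot>\<^sub>v 0\<^sub>v k + N0 *\<^sub>v u + (Rp * A) *\<^sub>v x) (sp - Rp *\<^sub>v b) \<and>
         1\<^sub>m ny *\<^sub>v f + t \<cdot>\<^sub>v 0\<^sub>v ny + N1 *\<^sub>v u = 0\<^sub>v ny) \<and>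
         0\<^sub>m 1 ny *\<^sub>v f + t \<cdot>\<^sub>v vec 1 (\<lambda>_. 1) + N2 *\<^sub>v u = 0\<^sub>v 1 \<longleftrightarrow>
      cone_le K (P *\<^sub>v f + t \<cdot>\<^sub>v p + Q *\<^sub>v u + R *\<^sub>v x) s"
    using N2(1) unfolding conic_constraint_def
    by (smt (verit) vec_carrier zero_carrier_mat)
  have feasible_iff: "feasible x f t fp tp up \<longleftrightarrow>
      cone_le K (P *\<^sub>v f + t \<cdot>\<^sub>v p + Q *\<^sub>v (fp @\<^sub>v (vec 1 (\<lambda>_. tp) @\<^sub>v up)) + R *\<^sub>v x) s"
    if v: "x \<in> carrier_vec nx" "f \<in> carrier_vec ny" "fp \<in> carrier_vec n\<eta>" "up \<in> carrier_vec nu"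
    for x f t fp tp up
  proof -
    let ?u = "fp @\<^sub>v (vec 1 (\<lambda>_. tp) @\<^sub>v up)"
    have u: "?u \<in> carrier_vec ?nu" using v by (intro append_carrier_vec) auto
    have "t \<cdot>\<^sub>v 0\<^sub>v k = 0\<^sub>v k" by (intro eq_vecI) auto
    then have "0\<^sub>m k ny *\<^sub>v f + t \<cdot>\<^sub>v 0\<^sub>v k + N0 *\<^sub>v ?u + (Rp * A) *\<^sub>v x =
        Pp *\<^sub>v fp + tp \<cdot>\<^sub>v pp + Qp *\<^sub>v up + Rp *\<^sub>v (A *\<^sub>v x)"
      using N0(2)[OF v(3,4)] v dims A
      by (simp add: assoc_mult_mat_vec[of _ k n\<xi> _ nx] zero_mat_mult_vec)
    moreover have "1\<^sub>m ny *\<^sub>v f + t \<cdot>\<^sub>v 0\<^sub>v ny + N1 *\<^sub>v ?u = f - B\<^sup>T *\<^sub>v fp"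
      unfolding N1(2)[OF v(3,4)] using v B
      by (intro eq_vecI) (auto simp: zero_mat_mult_vec simp del: index_mult_mat_vec)
    moreover have "f - B\<^sup>T *\<^sub>v fp = 0\<^sub>v ny \<longleftrightarrow> f = B\<^sup>T *\<^sub>v fp"
    proof
      assume eq: "f - B\<^sup>T *\<^sub>v fp = 0\<^sub>v ny"
      show "f = B\<^sup>T *\<^sub>v fp"
      proof (rule eq_vecI)
        fix i assume "i < dim_vec (B\<^sup>T *\<^sub>v fp)"
        then show "f $ i = (B\<^sup>T *\<^sub>v fp) $ i"
          using arg_cong[OF eq, of "\<lambda>v. v $ i"] v B by (simp del: index_mult_mat_vec)
      qed (use v B in auto)
    qed (use v in simp)
    moreover have "0\<^sub>m 1 ny *\<^sub>v f + t \<cdot>\<^sub>v vec 1 (\<lambda>_. 1) + N2 *\<^sub>v ?u = vec 1 (\<lambda>_. t - (tp + fp \<bullet> c))"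
      unfolding N2(2)[OF v(3,4)] Cf[OF v(3)] using v by (intro eq_vecI) auto
    moreover have "vec 1 (\<lambda>_. t - (tp + fp \<bullet> c)) = 0\<^sub>v 1 \<longleftrightarrow> t = tp + fp \<bullet> c"
      by (auto simp: vec_eq_iff)
    ultimately show ?thesis
      using iff[OF v(2) u v(1), of t] by (auto simp: feasible_def)
  qed
  have "K_representation \<K> nx ny X Y \<psi> ?nu l K P p Q R s"
    unfolding K_representation_def
  proof (intro conjI ballI)
    show "convex_concave_continuous nx ny X Y \<psi>"
      using convex_concave_continuous_affine[OF \<psi>p assms(4) X assms(8) Y A AX B BY \<psi>] .
    fix x y assume xy: "x \<in> X" "y \<in> Y"
    then have x: "x \<in> carrier_vec nx" using X by auto
    have "{ereal (f \<bullet> y + t) | f t fp tp up.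
             f \<in> carrier_vec ny \<and> fp \<in> carrier_vec n\<eta> \<and> up \<in> carrier_vec nu \<and>
             feasible x f t fp tp up} =
          {ereal (f \<bullet> y + t) | f t u.
             f \<in> carrier_vec ny \<and> u \<in> carrier_vec ?nu \<and>
             cone_le K (P *\<^sub>v f + t \<cdot>\<^sub>v p + Q *\<^sub>v u + R *\<^sub>v x) s}" (is "?L = ?R")
    proof
      have u: "fp @\<^sub>v (vec 1 (\<lambda>_. tp) @\<^sub>v up) \<in> carrier_vec ?nu"
        if "fp \<in> carrier_vec n\<eta>" "up \<in> carrier_vec nu" for fp up and tp :: real
        using that by (intro append_carrier_vec) auto
      show "?L \<subseteq> ?R" using feasible_iff[OF x] u by blast
      show "?R \<subseteq> ?L"
      proof
        fix r assume "r \<in> ?R"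
        then obtain f t u where r: "r = ereal (f \<bullet> y + t)" "f \<in> carrier_vec ny"
          "u \<in> carrier_vec ?nu" "cone_le K (P *\<^sub>v f + t \<cdot>\<^sub>v p + Q *\<^sub>v u + R *\<^sub>v x) s"
          by blast
        obtain fp tp up where "fp \<in> carrier_vec n\<eta>" "up \<in> carrier_vec nu"
          "u = fp @\<^sub>v (vec 1 (\<lambda>_. tp) @\<^sub>v up)"
          using carrier_vec_append_scalarE[OF r(3)] by blast
        with r feasible_iff[OF x, of f fp up t tp] show "r \<in> ?L" by blast
      qed
    qed
    with inf'[OF xy] show "ereal (\<psi> x y) = Inf ?R" by simp
  qed (use K carr in auto)
  with feasible_iff inf' show ?thesis by blast
qed

end
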